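(* Let $\Gamma$ be a group generated by a finite symmetric set $I=\{g_1,\dots,g_l,g_1^{-1},\dots,g_l^{-1}\}$ ($l\ge1$, $e\notin I$), and let $\Theta=\{0,1\}^\Gamma$. Let $\mathbb P$ and $\mathbb P_n$, $n\in\mathbb N$, be $\Gamma$-invariant probability measures on $\Theta$. If $(\mathbb P_n)$ converges weakly to $\mathbb P$, then the sequence of measure graphs $((G_{\Gamma,{\rm perc}},M_{\mathbb P_n}))$ converges weakly to $(G_{\Gamma,{\rm perc}},M_{\mathbb P})$. In particular, $\mathbb P_n\to\mathbb P$ weakly implies $$Z_{(G_{\Gamma,{\rm perc}},M_{\mathbb P_n})}\to Z_{(G_{\Gamma,{\rm perc}},M_{\mathbb P})}$$ uniformly on compact subsets of $B_{(2l-1)^{-1}}=\{u\in\mathbb C:|u|<(2l-1)^{-1}\}$.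
   Context: $\Theta=\{0,1\}^\Gamma$ carries the (compact) product topology and its Borel $\sigma$-algebra; $\Gamma$ acts by $\gamma\theta=\theta(\gamma^{-1}\,\cdot)$; weak convergence of measures is with respect to continuous functions on $\Theta$. $G_0$ is the Cayley graph: $\gamma\sim\gamma'$ iff $\gamma=\gamma'g$ for some $g\in I$. For $\theta\in\Theta$, $G_\theta$ is the graph with vertex set $\Gamma$ in which $\gamma,\gamma'$ are adjacent iff $\gamma\sim\gamma'$ in $G_0$ and $\theta(\gamma)=\theta(\gamma')=1$. $G_{\Gamma,{\rm perc}}$ is the graph with vertex set $V=\Gamma\times\Theta$ (product $\sigma$-algebra) in which $(\gamma,\theta)$ and $(\gamma',\theta')$ are adjacent iff $\theta=\theta'$ and $\gamma\sim\gamma'$ in $G_\theta$. For a $\Gamma$-invariant probability measure $\mathbb P$ on $\Theta$, $M_{\mathbb P}$ is the product of the counting measure on $\Gamma$ with $\mathbb P$. Here $(G_{\Gamma,{\rm perc}},M_{\mathbb P})$ is a measure graph over the groupoid $\Gamma\ltimes\Theta$; an averaging function is a measurable $\mathfrak u:V\to[0,\infty]$ with $\sum_{g\in\Gamma}\mathfrak u(g^{-1}\gamma,g^{-1}\theta)=1$ for all $(\gamma,\theta)\in V$, for example $\mathfrak u=1_{\{e\}\times\Theta}$; the integrals below do not depend on the choice of $\mathfrak u$. Rooted graphs: $B_r^G(x)$ is the induced graph on the ball of radius $r$ about $x$, rooted at $x$. The radius $\rho$ of a finite connected rooted graph is the maximal distance of a vertex from the root. $\mathcal A^D$ is the set of isomorphism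 classes of finite connected rooted graphs with degrees at most $D$. For $\alpha\in\mathcal A^D$, $V_\alpha=\{x\in V:B^{G_{\Gamma,{\rm perc}}}_{\rho(\alpha)}(x)\in\alpha\}$. Weak convergence of the measure graphs $(G_{\Gamma,{\rm perc}},M_{\mathbb P_n})$ to $(G_{\Gamma,{\rm perc}},M_{\mathbb P})$ means: for every $\alpha\in\mathcal A^{2l}$ (degrees of $G_{\Gamma,{\rm perc}}$ are at most $2l$), $\lim_n\int_{V_\alpha}\mathfrak u\,dM_{\mathbb P_n}=\int_{V_\alpha}\mathfrak u\,dM_{\mathbb P}$. Zeta function: a closed path $(e_1,\dots,e_j)$ (sequence of consecutive edges returning to its starting vertex) is reduced if $e_{i+1}\ne\bar e_i$ for $1\le i\le j-1$ and $\bar e_1\ne e_j$, where $\bar e$ is the reversed edge. $N_j^G(x)$ is the number of reduced closed paths of length $j$ in $G$ starting at $x$. $Z_{(G_{\Gamma,{\rm perc}},M_{\mathbb P})}(u)=\exp\bigl(\sum_{j\ge1}\frac{\overline N_j}ju^j\bigr)$ with $\overline N_j=\int_VN_j^{G_{\Gamma,{\rm perc}}}\,\mathfrak u\,dM_{\mathbb P}=\int_\Theta N_j^{G_\theta}(e)\,d\mathbb P(\theta)$. If $l=1$, $(2l-1)^{-1}=1$. *)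

theory Defs
  imports "HOL-Probability.Probability" "HOL-Library.Extended_Nat"
begin

text \<open>
  Groups are types of class \<open>group_add\<close>, the library's class of arbitrary, not necessarily
  commutative, groups; the group law is written additively, so the products
  \<open>\<gamma>' g\<close> and \<open>g\<^sup>-\<^sup>1 \<gamma>\<close> appear as \<open>\<gamma>' + g\<close> and \<open>- g + \<gamma>\<close>, in this order.
\<close>

definition subgroup_set :: "'g::group_add set \<Rightarrow> bool" where
  "subgroup_set H \<longleftrightarrow> 0 \<in> H \<and> (\<forall>a\<in>H. \<forall>b\<in>H. a + b \<in> H) \<and> (\<forall>a\<in>H. - a \<in> H)"

definition generates_group :: "'g::group_add set \<Rightarrow> bool" where
  "generates_group I \<longleftrightarrow> subgroup_set hull I = UNIV"


section \<open>Graphs\<close>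

record 'v ugraph =
  verts :: "'v set"
  adj :: "'v \<Rightarrow> 'v \<Rightarrow> bool"

record 'v rooted_graph = "'v ugraph" +
  groot :: 'v

definition simple_graph :: "('v, 'z) ugraph_scheme \<Rightarrow> bool" where
  "simple_graph G \<longleftrightarrow>
     (\<forall>x y. adj G x y \<longrightarrow> x \<in> verts G \<and> y \<in> verts G \<and> x \<noteq> y \<and> adj G y x)"

text \<open>\<open>adj G ^^ n\<close> relates the end points of walks of length \<open>n\<close>; vertices in different
  components have distance \<open>\<infinity>\<close>, the infimum of the empty set.\<close>

definition gdist :: "('v, 'z) ugraph_scheme \<Rightarrow> 'v \<Rightarrow> 'v \<Rightarrow> enat" where
  "gdist G x y = (INF n\<in>{n. (adj G ^^ n) x y}. enat n)"

definition connected_graph :: "('v, 'z) ugraph_scheme \<Rightarrow> bool" where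
  "connected_graph G \<longleftrightarrow> (\<forall>x\<in>verts G. \<forall>y\<in>verts G. gdist G x y < \<infinity>)"

definition rooted_ball :: "('v, 'z) ugraph_scheme \<Rightarrow> 'v \<Rightarrow> enat \<Rightarrow> 'v rooted_graph" where
  "rooted_ball G x r =
     (let B = {y \<in> verts G. gdist G x y \<le> r}
      in \<lparr>verts = B, adj = (\<lambda>a b. a \<in> B \<and> b \<in> B \<and> adj G a b), groot = x\<rparr>)"

definition radius :: "'v rooted_graph \<Rightarrow> enat" where
  "radius H = Max (gdist H (groot H) ` verts H)"

definition rooted_iso :: "'v rooted_graph \<Rightarrow> 'w rooted_graph \<Rightarrow> bool" where
  "rooted_iso G H \<longleftrightarrow>
     (\<exists>f. bij_betw f (verts G) (verts H) \<and> f (groot G) = groot H \<and>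
          (\<forall>x\<in>verts G. \<forall>y\<in>verts G. adj G x y \<longleftrightarrow> adj H (f x) (f y)))"

text \<open>Every finite graph is isomorphic to one whose vertices are natural numbers, so it suffices
  to form isomorphism classes among the latter; membership of a graph on another vertex type in
  such a class means being isomorphic to its elements.\<close>

definition finite_rooted_graphs :: "nat \<Rightarrow> nat rooted_graph set" where
  "finite_rooted_graphs D =
     {H. simple_graph H \<and> finite (verts H) \<and> groot H \<in> verts H \<and> connected_graph H \<and>
         (\<forall>x\<in>verts H. card {y. adj H x y} \<le> D)}"

definition rooted_classes :: "nat \<Rightarrow> nat rooted_graph set set" where
  "rooted_classes D =
     finite_rooted_graphs D //
       {(H, H'). H \<in> finite_rooted_graphs D \<and> H' \<in> finite_rooted_graphs D \<and> rooted_iso H H'}"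

text \<open>The radius is the same for all elements \<open>H\<close> of a class.\<close>

definition class_verts :: "('v, 'z) ugraph_scheme \<Rightarrow> nat rooted_graph set \<Rightarrow> 'v set" where
  "class_verts G \<alpha> = {x \<in> verts G. \<exists>H\<in>\<alpha>. rooted_iso (rooted_ball G x (radius H)) H}"

definition closed_path :: "('v, 'z) ugraph_scheme \<Rightarrow> 'v \<Rightarrow> ('v \<times> 'v) list \<Rightarrow> bool" where
  "closed_path G x es \<longleftrightarrow>
     es \<noteq> [] \<and> (\<forall>(a, b)\<in>set es. adj G a b) \<and>
     (\<forall>i. Suc i < length es \<longrightarrow> snd (es ! i) = fst (es ! Suc i)) \<and>
     fst (hd es) = x \<and> snd (last es) = x"

definition reduced_path :: "('v \<times> 'v) list \<Rightarrow> bool" where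
  "reduced_path es \<longleftrightarrow>
     (\<forall>i. Suc i < length es \<longrightarrow> es ! Suc i \<noteq> prod.swap (es ! i)) \<and>
     prod.swap (hd es) \<noteq> last es"

definition num_closed :: "('v, 'z) ugraph_scheme \<Rightarrow> nat \<Rightarrow> 'v \<Rightarrow> nat" where
  "num_closed G j x = card {es. length es = j \<and> closed_path G x es \<and> reduced_path es}"


section \<open>Percolation graphs over a Cayley graph\<close>

text \<open>\<open>'g \<Rightarrow> bool\<close> carries the library's product topology, with \<open>bool\<close> discrete,
  and \<open>borel\<close> is its Borel \<open>\<sigma>\<close>-algebra.\<close>

type_synonym 'g config = "'g \<Rightarrow> bool"

definition act :: "'g::group_add \<Rightarrow> 'g config \<Rightarrow> 'g config" where
  "act g \<theta> = (\<lambda>x. \<theta> (- g + x))"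

definition cayley_graph :: "'g::group_add set \<Rightarrow> 'g ugraph" where
  "cayley_graph I = \<lparr>verts = UNIV, adj = (\<lambda>x y. \<exists>g\<in>I. x = y + g)\<rparr>"

definition config_graph :: "'g::group_add set \<Rightarrow> 'g config \<Rightarrow> 'g ugraph" where
  "config_graph I \<theta> =
     \<lparr>verts = UNIV, adj = (\<lambda>x y. adj (cayley_graph I) x y \<and> \<theta> x \<and> \<theta> y)\<rparr>"

definition perc_graph :: "'g::group_add set \<Rightarrow> ('g \<times> 'g config) ugraph" where
  "perc_graph I =
     \<lparr>verts = UNIV,
      adj = (\<lambda>(x, \<theta>) (y, \<eta>). \<theta> = \<eta> \<and> adj (config_graph I \<theta>) x y)\<rparr>"

definition invariant_prob :: "'g::group_add config measure \<Rightarrow> bool" where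
  "invariant_prob P \<longleftrightarrow>
     prob_space P \<and> sets P = sets borel \<and> (\<forall>g. distr P borel (act g) = P)"

definition perc_measure :: "'g config measure \<Rightarrow> ('g \<times> 'g config) measure" where
  "perc_measure P = count_space UNIV \<Otimes>\<^sub>M P"

text \<open>The integral over \<open>count_space\<close> is the sum of a family in \<open>[0, \<infinity>]\<close>.\<close>

definition averaging_function :: "('g::group_add \<times> 'g config \<Rightarrow> ennreal) \<Rightarrow> bool" where
  "averaging_function u \<longleftrightarrow>
     u \<in> borel_measurable (count_space UNIV \<Otimes>\<^sub>M borel) \<and>
     (\<forall>x \<theta>. (\<integral>\<^sup>+g. u (- g + x, act (- g) \<theta>) \<partial>count_space UNIV) = 1)"


section \<open>Convergence and zeta functions\<close>

text \<open>\<open>\<Theta>\<close> is compact, so continuous functions on it are bounded.\<close>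

definition weakly_converges ::
    "(nat \<Rightarrow> 'a::topological_space measure) \<Rightarrow> 'a measure \<Rightarrow> bool" where
  "weakly_converges Pn P \<longleftrightarrow>
     (\<forall>f :: 'a \<Rightarrow> real. continuous_on UNIV f \<longrightarrow>
        (\<lambda>n. \<integral>\<theta>. f \<theta> \<partial>Pn n) \<longlonglongrightarrow> (\<integral>\<theta>. f \<theta> \<partial>P))"

text \<open>The limits below do not depend on the averaging function \<open>u\<close>; the condition is
  imposed for all of them rather than for a selected one. \<open>D\<close> bounds the degrees of \<open>G\<close>.\<close>

definition measure_graphs_converge ::
    "nat \<Rightarrow> ('g::group_add \<times> 'g config) ugraph \<Rightarrow>
     (nat \<Rightarrow> ('g \<times> 'g config) measure) \<Rightarrow> ('g \<times> 'g config) measure \<Rightarrow> bool" where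
  "measure_graphs_converge D G Mn M \<longleftrightarrow>
     (\<forall>u. averaging_function u \<longrightarrow>
       (\<forall>\<alpha>\<in>rooted_classes D.
          (\<lambda>n. \<integral>\<^sup>+v\<in>class_verts G \<alpha>. u v \<partial>Mn n) \<longlonglongrightarrow> (\<integral>\<^sup>+v\<in>class_verts G \<alpha>. u v \<partial>M)))"

text \<open>The integral is finite when \<open>G\<close> has bounded degrees and \<open>M = perc_measure P\<close>
  with \<open>P\<close> an invariant probability measure, so \<open>enn2real\<close> is harmless.\<close>

definition mean_closed ::
    "('g \<times> 'g config) ugraph \<Rightarrow> ('g \<times> 'g config) measure \<Rightarrow>
     ('g \<times> 'g config \<Rightarrow> ennreal) \<Rightarrow> nat \<Rightarrow> real" where
  "mean_closed G M u j = enn2real (\<integral>\<^sup>+v. of_nat (num_closed G j v) * u v \<partial>M)"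

definition zeta ::
    "('g \<times> 'g config) ugraph \<Rightarrow> ('g \<times> 'g config) measure \<Rightarrow>
     ('g \<times> 'g config \<Rightarrow> ennreal) \<Rightarrow> complex \<Rightarrow> complex" where
  "zeta G M u z =
     exp (\<Sum>j. of_real (mean_closed G M u (Suc j)) / of_nat (Suc j) * z ^ Suc j)"

end

theory Submission
  imports Defs
begin

text \<open>
  A walk in the percolation graph that starts at \<open>(x, \<theta>)\<close> is spelled out by a word over \<open>I\<close>, read
  from \<open>x\<close>, all of whose prefixes end at open sites. Therefore everything that can be seen from
  \<open>(x, \<theta>)\<close> within distance \<open>r\<close>, the isomorphism class of a ball as well as the number of reduced
  closed paths, is a function \<open>f\<close> of the translate \<open>act (- x) \<theta>\<close>, and \<open>f\<close> reads this configuration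
  on the finite set \<open>word_sums I r\<close> only
  (\<open>class_verts_perc_graph_local\<close>, \<open>num_closed_perc_graph\<close>, \<open>closed_words_cong\<close>).

  Two things follow. First, such a quantity is invariant under the diagonal action of the group, and
  for invariant \<open>P\<close> and any averaging function \<open>u\<close> the mass transport computation
  \<open>averaging_function_nn_integral\<close> evaluates its integral against \<open>u\<close> as the integral of \<open>f\<close> with
  respect to \<open>P\<close>. Secondly, \<open>f\<close> is locally constant on the configuration space, hence continuous,
  and weak convergence applies to it. This is already the convergence of the measure graphs, and it
  gives the convergence of every coefficient of the logarithm of the zeta function.

  Passing to the zeta functions requires a bound on the coefficients that is uniform in \<open>n\<close>. The
  first letter of a reduced word can be chosen in at most \<open>2 l\<close> ways and each later one in at most
  \<open>2 l - 1\<close> ways (\<open>card_reduced_words_le\<close>), so on a disc of radius less than \<open>1 / (2 l - 1)\<close> all the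
  series are dominated by one geometric series. Dominated convergence of series makes the exponents
  converge uniformly there, and the exponential function is uniformly continuous on bounded sets
  (\<open>uniform_limit_exp_power_series\<close>).
\<close>

section \<open>Walks as words\<close>

lemma act_uminus: "act (- x) \<theta> = (\<lambda>y. \<theta> (x + y))"
  by (simp add: act_def)

definition word_sums :: "'g::group_add set \<Rightarrow> nat \<Rightarrow> 'g set" where
  "word_sums I r = sum_list ` {w. set w \<subseteq> I \<and> length w \<le> r}"

text \<open>
  The condition is imposed on the two ends of each letter rather than on all prefixes, because an
  edge needs both of its ends open whereas the walk without edges exists at a closed site, too.
\<close>

definition open_word :: "'g::group_add config \<Rightarrow> 'g list \<Rightarrow> bool" where
  "open_word \<theta> w \<longleftrightarrow>
     (\<forall>i<length w. \<theta> (sum_list (take i w)) \<and> \<theta> (sum_list (take (Suc i) w)))"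

lemma sum_list_take_Suc:
  "i < length w \<Longrightarrow> sum_list (take (Suc i) w) = sum_list (take i w) + w ! i"
  for w :: "'g::monoid_add list"
  by (simp add: take_Suc_conv_app_nth)

lemma finite_word_sums: "finite I \<Longrightarrow> finite (word_sums I r)"
  unfolding word_sums_def by (intro finite_imageI finite_lists_length_le)

lemma sum_list_take_in_word_sums:
  assumes "set w \<subseteq> I" "length w \<le> r"
  shows "sum_list (take i w) \<in> word_sums I r"
  unfolding word_sums_def
  using assms set_take_subset[of i w] by (intro imageI) auto

lemma open_word_cong:
  assumes "\<And>t. t \<in> word_sums I r \<Longrightarrow> \<theta> t = \<eta> t" "set w \<subseteq> I" "length w \<le> r"
  shows "open_word \<theta> w \<longleftrightarrow> open_word \<eta> w"
  using assms(1)[OF sum_list_take_in_word_sums[OF assms(2,3)]] by (simp add: open_word_def)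

lemma open_word_snoc:
  "open_word \<theta> (w @ [g]) \<longleftrightarrow> open_word \<theta> w \<and> \<theta> (sum_list w) \<and> \<theta> (sum_list w + g)"
proof -
  have "open_word \<theta> (w @ [g]) \<longleftrightarrow>
      (\<forall>i<length w. \<theta> (sum_list (take i (w @ [g]))) \<and> \<theta> (sum_list (take (Suc i) (w @ [g])))) \<and>
      \<theta> (sum_list w) \<and> \<theta> (sum_list w + g)"
    by (auto simp: open_word_def less_Suc_eq)
  then show ?thesis by (simp add: open_word_def Suc_le_eq)
qed

text \<open>
  The edges of the Cayley graph are given by \<open>x = y + g\<close>; symmetry of \<open>I\<close> turns this into steps
  \<open>x + g\<close> that start at \<open>x\<close>, which is the direction in which words are read.
\<close>

lemma adj_perc_graph:
  assumes "uminus ` I \<subseteq> I"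
  shows "adj (perc_graph I) (x, \<theta>) v \<longleftrightarrow>
     (\<exists>g\<in>I. v = (x + g, \<theta>)) \<and> \<theta> x \<and> \<theta> (fst v)"
proof -
  have "(\<exists>g\<in>I. x = y + g) \<longleftrightarrow> (\<exists>g\<in>I. y = x + g)" for y
  proof
    assume "\<exists>g\<in>I. x = y + g"
    then obtain g where "g \<in> I" "x = y + g" by blast
    with assms show "\<exists>g\<in>I. y = x + g"
      by (intro bexI[of _ "- g"]) (auto simp: add.assoc)
  next
    assume "\<exists>g\<in>I. y = x + g"
    then obtain g where "g \<in> I" "y = x + g" by blast
    with assms show "\<exists>g\<in>I. x = y + g"
      by (intro bexI[of _ "- g"]) (auto simp: add.assoc)
  qed
  then show ?thesis
    by (cases v) (auto simp: perc_graph_def config_graph_def cayley_graph_def)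
qed

lemma relpowp_perc_graph:
  assumes "uminus ` I \<subseteq> I"
  shows "(adj (perc_graph I) ^^ n) (x, \<theta>) v \<longleftrightarrow>
     (\<exists>w. set w \<subseteq> I \<and> length w = n \<and> open_word (act (- x) \<theta>) w \<and> v = (x + sum_list w, \<theta>))"
proof (induction n arbitrary: v)
  case 0
  then show ?case by (auto simp: open_word_def)
next
  case (Suc n)
  show ?case (is "?l \<longleftrightarrow> ?r")
  proof
    assume ?l
    then obtain v' where "(adj (perc_graph I) ^^ n) (x, \<theta>) v'" and e: "adj (perc_graph I) v' v"
      by auto
    then obtain w where w: "set w \<subseteq> I" "length w = n" "open_word (act (- x) \<theta>) w"
      "v' = (x + sum_list w, \<theta>)"
      using Suc.IH by blast
    obtain g where "g \<in> I" "v = (x + sum_list w + g, \<theta>)" "\<theta> (x + sum_list w)"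
      "\<theta> (x + sum_list w + g)"
      using e unfolding w(4) adj_perc_graph[OF assms] by auto
    with w show ?r
      by (intro exI[of _ "w @ [g]"]) (simp add: open_word_snoc act_uminus add.assoc)
  next
    assume ?r
    then obtain w' where w': "set w' \<subseteq> I" "length w' = Suc n" "open_word (act (- x) \<theta>) w'"
      "v = (x + sum_list w', \<theta>)" by blast
    then obtain w g where [simp]: "w' = w @ [g]"
      by (cases w' rule: rev_cases) auto
    have "(adj (perc_graph I) ^^ n) (x, \<theta>) (x + sum_list w, \<theta>)"
      using w' by (subst Suc.IH) (auto simp: open_word_snoc)
    moreover have "adj (perc_graph I) (x + sum_list w, \<theta>) v"
      using w' by (subst adj_perc_graph[OF assms])
        (auto simp: open_word_snoc act_uminus add.assoc)
    ultimately show ?l by auto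
  qed
qed

text \<open>
  Extended natural numbers are well-ordered, so the infimum that defines the distance is attained
  unless there is no walk at all, in which case it is infinite.
\<close>

lemma gdist_le_iff: "gdist G x y \<le> enat r \<longleftrightarrow> (\<exists>n\<le>r. (adj G ^^ n) x y)"
proof
  assume le: "gdist G x y \<le> enat r"
  let ?A = "enat ` {n. (adj G ^^ n) x y}"
  have "?A \<noteq> {}"
  proof
    assume "?A = {}"
    then have "gdist G x y = Inf {}"
      unfolding gdist_def by (rule arg_cong)
    with le show False by (simp add: top_enat_def)
  qed
  then have "gdist G x y \<in> ?A"
    unfolding gdist_def by (metis Inf_enat_def LeastI_ex ex_in_conv)
  with le show "\<exists>n\<le>r. (adj G ^^ n) x y" by auto
next
  assume "\<exists>n\<le>r. (adj G ^^ n) x y"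
  then obtain n where "n \<le> r" "(adj G ^^ n) x y" by blast
  then have "gdist G x y \<le> enat n"
    unfolding gdist_def by (intro INF_lower) simp
  with \<open>n \<le> r\<close> show "gdist G x y \<le> enat r"
    by (metis enat_ord_simps(1) order_trans)
qed

text \<open>
  Countability makes the counting measure \<open>\<sigma>\<close>-finite, as the exchange of sum and integral in the
  mass transport argument requires. Sums of words over \<open>I\<close> form a subgroup, and there are countably
  many words.
\<close>

lemma countable_if_generates_group:
  fixes I :: "'g::group_add set"
  assumes "finite I" "uminus ` I \<subseteq> I" "generates_group I"
  shows "countable (UNIV :: 'g set)"
proof -
  let ?H = "sum_list ` lists I :: 'g set"
  have neg: "- sum_list w = sum_list (rev (map uminus w))" for w :: "'g list"
    by (induction w) (simp_all add: minus_add)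
  have "subgroup_set ?H"
    unfolding subgroup_set_def
  proof (intro conjI ballI)
    show "0 \<in> ?H" by (rule image_eqI[of _ _ "[]"]) auto
  next
    fix a b assume "a \<in> ?H" "b \<in> ?H"
    then obtain v w where "v \<in> lists I" "w \<in> lists I" "a = sum_list v" "b = sum_list w" by blast
    then show "a + b \<in> ?H" by (intro image_eqI[of _ _ "v @ w"]) auto
  next
    fix a assume "a \<in> ?H"
    then obtain w where "w \<in> lists I" "a = sum_list w" by blast
    with assms(2) show "- a \<in> ?H"
      by (intro image_eqI[of _ _ "rev (map uminus w)"]) (auto simp: neg image_subset_iff)
  qed
  moreover have "I \<subseteq> ?H"
  proof
    fix g assume "g \<in> I"
    then show "g \<in> ?H" by (intro image_eqI[of _ _ "[g]"]) auto
  qed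
  ultimately have "subgroup_set hull I \<subseteq> ?H"
    by (rule hull_minimal[rotated])
  then have "UNIV \<subseteq> ?H"
    using assms(3) by (simp add: generates_group_def)
  moreover have "countable ?H"
    using assms(1) by (intro countable_image countable_lists countable_finite)
  ultimately show ?thesis
    by (rule countable_subset)
qed

section \<open>Balls\<close>

definition reachable :: "'g::group_add set \<Rightarrow> nat \<Rightarrow> 'g config \<Rightarrow> 'g set" where
  "reachable I r \<theta> = sum_list ` {w. set w \<subseteq> I \<and> length w \<le> r \<and> open_word \<theta> w}"

lemma verts_rooted_ball_perc_graph:
  assumes "uminus ` I \<subseteq> I"
  shows "verts (rooted_ball (perc_graph I) (x, \<theta>) (enat r)) =
    (\<lambda>t. (x + t, \<theta>)) ` reachable I r (act (- x) \<theta>)"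
proof -
  have "v \<in> verts (rooted_ball (perc_graph I) (x, \<theta>) (enat r)) \<longleftrightarrow>
     (\<exists>n\<le>r. (adj (perc_graph I) ^^ n) (x, \<theta>) v)" for v
    by (simp add: rooted_ball_def gdist_le_iff) (simp add: perc_graph_def)
  then show ?thesis
    unfolding relpowp_perc_graph[OF assms] reachable_def by auto
qed

lemma rooted_iso_trans:
  assumes "rooted_iso G H" "rooted_iso H K"
  shows "rooted_iso G K"
proof -
  obtain f where f: "bij_betw f (verts G) (verts H)" "f (groot G) = groot H"
    "\<And>x y. x \<in> verts G \<Longrightarrow> y \<in> verts G \<Longrightarrow> adj G x y \<longleftrightarrow> adj H (f x) (f y)"
    using assms(1) unfolding rooted_iso_def by blast
  obtain g where g: "bij_betw g (verts H) (verts K)" "g (groot H) = groot K"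
    "\<And>x y. x \<in> verts H \<Longrightarrow> y \<in> verts H \<Longrightarrow> adj H x y \<longleftrightarrow> adj K (g x) (g y)"
    using assms(2) unfolding rooted_iso_def by blast
  show ?thesis
    unfolding rooted_iso_def
    using f g bij_betw_trans[OF f(1) g(1)] bij_betwE[OF f(1)]
    by (intro exI[of _ "g \<circ> f"]) auto
qed

text \<open>
  The isomorphism is the translation that takes \<open>x\<close> to \<open>y\<close>: walks of length at most \<open>r\<close> are words
  that test openness at points of \<open>word_sums I r\<close> relative to the root, where \<open>\<theta>\<close> seen from \<open>x\<close> and
  \<open>\<eta>\<close> seen from \<open>y\<close> coincide. Translation invariance is the case \<open>\<eta> = act g \<theta>\<close>, \<open>y = g + x\<close>, and
  dependence on finitely many sites is the case \<open>x = y\<close>.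
\<close>

lemma rooted_ball_perc_graph_iso:
  fixes I :: "'g::group_add set"
  assumes sym: "uminus ` I \<subseteq> I"
    and agree: "\<And>t. t \<in> word_sums I r \<Longrightarrow> \<theta> (x + t) = \<eta> (y + t)"
  shows "rooted_iso (rooted_ball (perc_graph I) (x, \<theta>) (enat r))
     (rooted_ball (perc_graph I) (y, \<eta>) (enat r))"
proof -
  define R where "R = reachable I r (act (- x) \<theta>)"
  have R': "reachable I r (act (- y) \<eta>) = R"
    unfolding R_def reachable_def using agree open_word_cong[of I r "act (- x) \<theta>" "act (- y) \<eta>"]
    by (intro arg_cong[where f = "image sum_list"] Collect_cong) (auto simp: act_uminus)
  have R_sub: "R \<subseteq> word_sums I r"
    by (auto simp: R_def reachable_def word_sums_def)
  define f where "f v = (y + (- x + fst v), \<eta>)" for v :: "'g \<times> 'g config"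
  let ?G = "rooted_ball (perc_graph I) (x, \<theta>) (enat r)"
  let ?H = "rooted_ball (perc_graph I) (y, \<eta>) (enat r)"
  have VG: "verts ?G = (\<lambda>t. (x + t, \<theta>)) ` R"
    and VH: "verts ?H = (\<lambda>t. (y + t, \<eta>)) ` R"
    using verts_rooted_ball_perc_graph[OF sym] R' by (simp_all add: R_def)
  have f_at: "f (x + t, \<theta>) = (y + t, \<eta>)" for t
    by (simp add: f_def add.assoc[symmetric])
  have "bij_betw f (verts ?G) (verts ?H)"
    unfolding bij_betw_def
  proof
    show "inj_on f (verts ?G)"
      by (auto simp: VG f_at intro!: inj_onI)
    show "f ` verts ?G = verts ?H"
      by (simp add: VG VH image_image f_at)
  qed
  moreover have "f (groot ?G) = groot ?H"
    using f_at[of 0] by (simp add: rooted_ball_def Let_def)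
  moreover have "adj ?G v v' \<longleftrightarrow> adj ?H (f v) (f v')" if v_in: "v \<in> verts ?G" "v' \<in> verts ?G" for v v'
  proof -
    have adj_ball: "adj (rooted_ball G z k) a b \<longleftrightarrow>
        a \<in> verts (rooted_ball G z k) \<and> b \<in> verts (rooted_ball G z k) \<and> adj G a b"
      for G :: "('g \<times> 'g config) ugraph" and z k a b
      by (auto simp: rooted_ball_def Let_def)
    obtain t t' where t: "t \<in> R" "t' \<in> R" and v: "v = (x + t, \<theta>)" "v' = (x + t', \<theta>)"
      using v_in by (auto simp: VG)
    have "adj (perc_graph I) v v' \<longleftrightarrow> adj (perc_graph I) (f v) (f v')"
      using t R_sub agree by (auto simp: v f_at adj_perc_graph[OF sym] add.assoc)
    moreover have "f v \<in> verts ?H" "f v' \<in> verts ?H"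
      using t by (auto simp: v f_at VH)
    ultimately show ?thesis
      using v_in by (simp add: adj_ball)
  qed
  ultimately show ?thesis
    unfolding rooted_iso_def by blast
qed

text \<open>
  Simplicity keeps all intermediate vertices of a walk inside the vertex sets, where the
  isomorphism can be applied.
\<close>

lemma relpowp_adj_iso:
  assumes "simple_graph G" "simple_graph H" and bij: "bij_betw f (verts G) (verts H)"
    and adj: "\<And>x y. x \<in> verts G \<Longrightarrow> y \<in> verts G \<Longrightarrow> adj G x y \<longleftrightarrow> adj H (f x) (f y)"
    and "x \<in> verts G" "y \<in> verts G"
  shows "(adj G ^^ n) x y \<longleftrightarrow> (adj H ^^ n) (f x) (f y)"
  using \<open>y \<in> verts G\<close>
proof (induction n arbitrary: y)
  case 0
  then show ?case
    using bij \<open>x \<in> verts G\<close> by (auto simp: bij_betw_def inj_on_def)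
next
  case (Suc n)
  have "(\<exists>z. (adj G ^^ n) x z \<and> adj G z y) \<longleftrightarrow> (\<exists>z\<in>verts G. (adj G ^^ n) x z \<and> adj G z y)"
    using assms(1) by (auto simp: simple_graph_def)
  also have "\<dots> \<longleftrightarrow> (\<exists>z\<in>verts G. (adj H ^^ n) (f x) (f z) \<and> adj H (f z) (f y))"
    using Suc adj by blast
  also have "\<dots> \<longleftrightarrow> (\<exists>z\<in>verts H. (adj H ^^ n) (f x) z \<and> adj H z (f y))"
    unfolding bij_betw_imp_surj_on[OF bij, symmetric] by blast
  also have "\<dots> \<longleftrightarrow> (\<exists>z. (adj H ^^ n) (f x) z \<and> adj H z (f y))"
    using assms(2) by (auto simp: simple_graph_def)
  finally show ?case by (simp add: relcompp_apply)
qed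

lemma radius_cong_rooted_iso:
  assumes "simple_graph G" "simple_graph H" "rooted_iso G H" "groot G \<in> verts G"
  shows "radius G = radius H"
proof -
  obtain f where f: "bij_betw f (verts G) (verts H)" "f (groot G) = groot H"
    "\<And>x y. x \<in> verts G \<Longrightarrow> y \<in> verts G \<Longrightarrow> adj G x y \<longleftrightarrow> adj H (f x) (f y)"
    using assms(3) unfolding rooted_iso_def by blast
  have "gdist G (groot G) y = gdist H (groot H) (f y)" if "y \<in> verts G" for y
    unfolding gdist_def f(2)[symmetric] using relpowp_adj_iso[OF assms(1,2) f(1,3) assms(4) that]
    by simp
  then have "gdist G (groot G) ` verts G = gdist H (groot H) ` f ` verts G"
    unfolding image_image by (rule image_cong[OF refl])
  then show ?thesis
    unfolding radius_def bij_betw_imp_surj_on[OF f(1)] by simp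
qed

lemma radius_finite:
  assumes "H \<in> finite_rooted_graphs D"
  obtains r where "radius H = enat r"
proof -
  have H: "finite (verts H)" "groot H \<in> verts H" "connected_graph H"
    using assms by (auto simp: finite_rooted_graphs_def)
  then have "radius H \<in> gdist H (groot H) ` verts H"
    unfolding radius_def by (intro Max_in) auto
  then have "radius H < \<infinity>"
    using H by (auto simp: connected_graph_def)
  then show thesis
    using that by auto
qed

text \<open>
  All members of \<open>\<alpha>\<close> have the same finite radius, so membership of a vertex is decided by its ball of
  one fixed radius \<open>r\<close>.
\<close>

lemma class_verts_perc_graph_local:
  fixes I :: "'g::group_add set"
  assumes sym: "uminus ` I \<subseteq> I" and \<alpha>: "\<alpha> \<in> rooted_classes D"
  shows "\<exists>r. \<forall>x \<theta> y \<eta>. (\<forall>t\<in>word_sums I r. \<theta> (x + t) = \<eta> (y + t)) \<longrightarrow>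
     ((x, \<theta>) \<in> class_verts (perc_graph I) \<alpha> \<longleftrightarrow> (y, \<eta>) \<in> class_verts (perc_graph I) \<alpha>)"
proof -
  obtain H0 where H0: "H0 \<in> finite_rooted_graphs D"
    and \<alpha>_eq: "\<alpha> = {H. H \<in> finite_rooted_graphs D \<and> rooted_iso H0 H}"
    using \<alpha> unfolding rooted_classes_def quotient_def by auto
  obtain r where r: "radius H0 = enat r"
    using radius_finite[OF H0] .
  have radius: "radius H = enat r" if "H \<in> \<alpha>" for H
    using that H0 radius_cong_rooted_iso[of H0 H] r
    by (auto simp: \<alpha>_eq finite_rooted_graphs_def)
  have mem: "v \<in> class_verts (perc_graph I) \<alpha> \<longleftrightarrow>
      (\<exists>H\<in>\<alpha>. rooted_iso (rooted_ball (perc_graph I) v (enat r)) H)" for v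
    using radius by (auto simp: class_verts_def perc_graph_def)
  have "(y, \<eta>) \<in> class_verts (perc_graph I) \<alpha>"
    if "(x, \<theta>) \<in> class_verts (perc_graph I) \<alpha>" "\<And>t. t \<in> word_sums I r \<Longrightarrow> \<theta> (x + t) = \<eta> (y + t)"
    for x \<theta> y \<eta>
    using that rooted_iso_trans[OF rooted_ball_perc_graph_iso[OF sym, of r \<eta> y \<theta> x]]
    unfolding mem by metis
  then show ?thesis
    by (intro exI[of _ r]) metis
qed

section \<open>Closed paths\<close>

text \<open>
  Two consecutive edges of a path are mutually reverse iff the corresponding letters are opposite.
\<close>

definition reduced_words :: "'g::group_add set \<Rightarrow> nat \<Rightarrow> 'g list set" where
  "reduced_words I j =
     {w. set w \<subseteq> I \<and> length w = j \<and> (\<forall>i. Suc i < j \<longrightarrow> w ! Suc i \<noteq> - (w ! i))}"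

text \<open>
  The condition on the last and the first letter excludes a closed path whose last edge is the
  reverse of its first one.
\<close>

definition closed_words :: "'g::group_add set \<Rightarrow> nat \<Rightarrow> 'g config \<Rightarrow> 'g list set" where
  "closed_words I j \<theta> =
     {w \<in> reduced_words I j. last w \<noteq> - hd w \<and> sum_list w = 0 \<and> open_word \<theta> w}"

definition word_path :: "'g::group_add \<Rightarrow> 'g config \<Rightarrow> 'g list \<Rightarrow>
    (('g \<times> 'g config) \<times> ('g \<times> 'g config)) list" where
  "word_path x \<theta> w =
     map (\<lambda>i. ((x + sum_list (take i w), \<theta>), (x + sum_list (take (Suc i) w), \<theta>))) [0..<length w]"

lemma length_word_path [simp]: "length (word_path x \<theta> w) = length w"
  by (simp add: word_path_def)

lemma nth_word_path:
  "i < length w \<Longrightarrow> word_path x \<theta> w ! i =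
     ((x + sum_list (take i w), \<theta>), (x + sum_list (take (Suc i) w), \<theta>))"
  by (simp add: word_path_def)

lemma closed_path_word_path:
  fixes I :: "'g::group_add set"
  assumes sym: "uminus ` I \<subseteq> I" and "w \<noteq> []"
  shows "closed_path (perc_graph I) (x, \<theta>) (word_path x \<theta> w) \<longleftrightarrow>
     set w \<subseteq> I \<and> open_word (act (- x) \<theta>) w \<and> sum_list w = 0"
proof -
  let ?s = "\<lambda>i. sum_list (take i w)"
  have ne: "word_path x \<theta> w \<noteq> []"
    using \<open>w \<noteq> []\<close> by (metis length_0_conv length_word_path)
  have "(\<forall>(a, b)\<in>set (word_path x \<theta> w). adj (perc_graph I) a b) \<longleftrightarrow>
      (\<forall>i<length w. w ! i \<in> I \<and> \<theta> (x + ?s i) \<and> \<theta> (x + ?s (Suc i)))"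
  proof -
    have "(\<forall>(a, b)\<in>set (word_path x \<theta> w). adj (perc_graph I) a b) \<longleftrightarrow>
      (\<forall>i<length w. adj (perc_graph I) (x + ?s i, \<theta>) (x + ?s (Suc i), \<theta>))"
      unfolding all_set_conv_all_nth by (simp add: nth_word_path)
    also have "\<dots> \<longleftrightarrow> (\<forall>i<length w. w ! i \<in> I \<and> \<theta> (x + ?s i) \<and> \<theta> (x + ?s (Suc i)))"
      by (auto simp: adj_perc_graph[OF sym] sum_list_take_Suc add.assoc)
    finally show ?thesis .
  qed
  moreover have "(\<forall>i<length w. w ! i \<in> I) \<longleftrightarrow> set w \<subseteq> I"
    by (simp add: subset_eq all_set_conv_all_nth)
  moreover have "snd (last (word_path x \<theta> w)) = (x + sum_list w, \<theta>)"
    using ne \<open>w \<noteq> []\<close> by (simp add: last_conv_nth nth_word_path)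
  moreover have "fst (hd (word_path x \<theta> w)) = (x, \<theta>)"
    using ne \<open>w \<noteq> []\<close> by (simp add: hd_conv_nth nth_word_path)
  moreover have "\<forall>i. Suc i < length w \<longrightarrow>
      snd (word_path x \<theta> w ! i) = fst (word_path x \<theta> w ! Suc i)"
    by (simp add: nth_word_path)
  moreover have "x + a = x \<longleftrightarrow> a = 0" for a
    by (metis add_0_right add_left_cancel)
  ultimately show ?thesis
    using ne unfolding closed_path_def open_word_def act_uminus by auto
qed

lemma reduced_path_word_path:
  fixes w :: "'g::group_add list"
  assumes "w \<noteq> []" "sum_list w = 0"
  shows "reduced_path (word_path x \<theta> w) \<longleftrightarrow>
     (\<forall>i. Suc i < length w \<longrightarrow> w ! Suc i \<noteq> - (w ! i)) \<and> last w \<noteq> - hd w"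
proof -
  let ?p = "word_path x \<theta> w"
  have ne: "?p \<noteq> []"
    using \<open>w \<noteq> []\<close> by (metis length_0_conv length_word_path)
  have "a + g + h = a \<longleftrightarrow> h = - g" for a g h :: 'g
    unfolding eq_commute[of h] neg_eq_iff_add_eq_0
    using add_left_cancel[of a "g + h" 0] by (simp add: add.assoc)
  then have "?p ! Suc i = prod.swap (?p ! i) \<longleftrightarrow> w ! Suc i = - (w ! i)"
    if "Suc i < length w" for i
    using that by (simp add: nth_word_path sum_list_take_Suc add.assoc[symmetric])
  moreover have "prod.swap (hd ?p) = last ?p \<longleftrightarrow> last w = - hd w"
  proof -
    \<comment> \<open>the word is a closed one, so the prefix without the last letter sums to \<open>- last w\<close>\<close>
    let ?n = "length w - 1"
    have n: "length w = Suc ?n" "?n < length w"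
      using \<open>w \<noteq> []\<close> by (cases w; simp)+
    have "sum_list (take ?n w) + last w = 0"
      using sum_list_take_Suc[OF n(2)] n(1) \<open>w \<noteq> []\<close> assms(2) by (simp add: last_conv_nth)
    then have s: "sum_list (take ?n w) = - last w"
      by (simp add: eq_neg_iff_add_eq_0)
    have "hd ?p = ((x, \<theta>), (x + hd w, \<theta>))"
      using ne \<open>w \<noteq> []\<close> by (cases w) (simp_all add: hd_conv_nth nth_word_path)
    moreover have "last ?p = ((x + - last w, \<theta>), (x, \<theta>))"
      using ne n assms(2) s by (simp add: last_conv_nth nth_word_path)
    moreover have "x + hd w = x + - last w \<longleftrightarrow> last w = - hd w"
      unfolding add_left_cancel by (metis minus_minus)
    ultimately show ?thesis
      by (simp del: add_uminus_conv_diff)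
  qed
  ultimately show ?thesis
    unfolding reduced_path_def by auto
qed

text \<open>
  An edge from \<open>a\<close> to \<open>b\<close> is recovered from its letter \<open>- a + b\<close>, and the configuration never
  changes along a path; hence every closed path comes from a word.
\<close>

lemma word_path_surj:
  fixes I :: "'g::group_add set"
  assumes "closed_path (perc_graph I) (x, \<theta>) es"
  shows "es = word_path x \<theta> (map (\<lambda>(a, b). - fst a + fst b) es)"
proof -
  let ?w = "map (\<lambda>(a, b). - fst a + fst b) es"
  have edge: "adj (perc_graph I) (fst (es ! i)) (snd (es ! i))" if "i < length es" for i
    using assms that by (force simp: closed_path_def all_set_conv_all_nth split_beta)
  have cons: "snd (es ! i) = fst (es ! Suc i)" if "Suc i < length es" for i
    using assms that by (simp add: closed_path_def)
  have snd_edge: "snd (es ! i) = (fst (fst (es ! i)) + ?w ! i, snd (fst (es ! i)))"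
    if "i < length es" for i
    using edge[OF that] that
    by (auto simp: perc_graph_def split_beta add.assoc[symmetric] prod_eq_iff)
  have fst_edge: "fst (es ! i) = (x + sum_list (take i ?w), \<theta>)" if "i < length es" for i
    using that
  proof (induction i)
    case 0
    then show ?case
      using assms by (simp add: closed_path_def hd_conv_nth)
  next
    case (Suc i)
    then show ?case
      using snd_edge[of i] cons[of i] sum_list_take_Suc[of i ?w] by (simp add: add.assoc)
  qed
  show ?thesis
  proof (rule nth_equalityI)
    fix i assume "i < length es"
    then show "es ! i = word_path x \<theta> ?w ! i"
      using fst_edge[of i] snd_edge[of i] sum_list_take_Suc[of i ?w]
      by (simp add: nth_word_path prod_eq_iff add.assoc)
  qed simp
qed

lemma num_closed_perc_graph:
  assumes sym: "uminus ` I \<subseteq> I"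
  shows "num_closed (perc_graph I) (Suc j) (x, \<theta>) =
    card (closed_words I (Suc j) (act (- x) \<theta>))"
proof -
  let ?E = "{es. length es = Suc j \<and> closed_path (perc_graph I) (x, \<theta>) es \<and> reduced_path es}"
  let ?W = "closed_words I (Suc j) (act (- x) \<theta>)"
  have iff: "word_path x \<theta> w \<in> ?E \<longleftrightarrow> w \<in> ?W" if "length w = Suc j" for w
  proof -
    have "w \<noteq> []" using that by auto
    then show ?thesis
      using that closed_path_word_path[OF sym \<open>w \<noteq> []\<close>] reduced_path_word_path[OF \<open>w \<noteq> []\<close>]
      by (auto simp: closed_words_def reduced_words_def)
  qed
  have "bij_betw (word_path x \<theta>) ?W ?E"
    unfolding bij_betw_def
  proof
    show "inj_on (word_path x \<theta>) ?W"
    proof (rule inj_on_inverseI)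
      fix w
      show "map (\<lambda>(a, b). - fst a + fst b) (word_path x \<theta> w) = w"
        by (rule nth_equalityI)
          (simp_all add: nth_word_path sum_list_take_Suc add.assoc[symmetric, of x])
    qed
    show "word_path x \<theta> ` ?W = ?E"
    proof (intro subset_antisym subsetI)
      fix es assume "es \<in> word_path x \<theta> ` ?W"
      then show "es \<in> ?E"
        using iff by (auto simp: closed_words_def reduced_words_def)
    next
      fix es assume es: "es \<in> ?E"
      then have eq: "es = word_path x \<theta> (map (\<lambda>(a, b). - fst a + fst b) es)"
        using word_path_surj by blast
      have "map (\<lambda>(a, b). - fst a + fst b) es \<in> ?W"
        using es by (subst iff[symmetric]) (simp_all add: eq[symmetric])
      then show "es \<in> word_path x \<theta> ` ?W"
        using eq by (rule image_eqI[rotated])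
    qed
  qed
  then show ?thesis
    unfolding num_closed_def by (simp add: bij_betw_same_card)
qed

lemma closed_words_cong:
  assumes "\<And>t. t \<in> word_sums I j \<Longrightarrow> \<theta> t = \<eta> t"
  shows "closed_words I j \<theta> = closed_words I j \<eta>"
  unfolding closed_words_def reduced_words_def
  using open_word_cong[of I j \<theta> \<eta>, OF assms] by (intro Collect_cong) auto

lemma finite_reduced_words: "finite I \<Longrightarrow> finite (reduced_words I j)"
  by (rule finite_subset[OF _ finite_lists_length_eq[of I j]]) (auto simp: reduced_words_def)

text \<open>
  Appending a letter to a reduced word excludes the opposite of its last letter, which belongs to \<open>I\<close>
  because \<open>I\<close> is symmetric.
\<close>

lemma card_reduced_words_le:
  assumes fin: "finite I" and sym: "uminus ` I \<subseteq> I"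
  shows "card (reduced_words I (Suc j)) \<le> card I * (card I - 1) ^ j"
proof (induction j)
  case 0
  have "reduced_words I (Suc 0) \<subseteq> (\<lambda>g. [g]) ` I"
    by (auto simp: reduced_words_def length_Suc_conv)
  then have "card (reduced_words I (Suc 0)) \<le> card I"
    using fin by (meson card_image_le card_mono finite_imageI order_trans)
  then show ?case by simp
next
  case (Suc j)
  let ?R = "reduced_words I (Suc j)"
  have "reduced_words I (Suc (Suc j)) \<subseteq>
      (\<lambda>(w, g). w @ [g]) ` (SIGMA w:?R. I - {- last w})"
  proof
    fix w' assume w': "w' \<in> reduced_words I (Suc (Suc j))"
    then obtain w g where eq: "w' = w @ [g]"
      by (cases w' rule: rev_cases) (auto simp: reduced_words_def)
    have len: "length w = Suc j"
      using w' by (simp add: reduced_words_def eq)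
    then have "w \<noteq> []" by auto
    have red: "w' ! Suc i \<noteq> - (w' ! i)" if "Suc i < Suc (Suc j)" for i
      using w' that by (simp add: reduced_words_def)
    have "w ! Suc i \<noteq> - (w ! i)" if "Suc i < Suc j" for i
      using red[of i] that len by (simp add: eq nth_append)
    moreover have "g \<noteq> - last w"
      using red[of j] len \<open>w \<noteq> []\<close> by (auto simp: eq nth_append last_conv_nth)
    ultimately have "(w, g) \<in> (SIGMA w:?R. I - {- last w})"
      using w' len by (auto simp: eq reduced_words_def)
    then show "w' \<in> (\<lambda>(w, g). w @ [g]) ` (SIGMA w:?R. I - {- last w})"
      unfolding eq by (rule rev_image_eqI) simp
  qed
  moreover have fin_S: "finite (SIGMA w:?R. I - {- last w})"
    using fin finite_reduced_words[OF fin] by (intro finite_SigmaI) auto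
  ultimately have "card (reduced_words I (Suc (Suc j))) \<le> card (SIGMA w:?R. I - {- last w})"
    by (meson card_image_le card_mono finite_imageI order_trans)
  also have "\<dots> = (\<Sum>w\<in>?R. card (I - {- last w}))"
    using fin finite_reduced_words[OF fin] by (intro card_SigmaI) auto
  also have "\<dots> = (\<Sum>w\<in>?R. card I - 1)"
  proof (rule sum.cong[OF refl])
    fix w assume "w \<in> ?R"
    then have "last w \<in> I"
      by (cases w rule: rev_cases) (auto simp: reduced_words_def)
    then show "card (I - {- last w}) = card I - 1"
      using sym fin by (intro card_Diff_singleton) (auto simp: image_subset_iff)
  qed
  also have "\<dots> \<le> card I * (card I - 1) ^ j * (card I - 1)"
    using Suc by simp
  finally show ?case by (simp add: ac_simps)
qed

lemma card_closed_words_le: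
  assumes "finite I" "uminus ` I \<subseteq> I"
  shows "card (closed_words I (Suc j) \<theta>) \<le> card I * (card I - 1) ^ j"
proof -
  have "card (closed_words I (Suc j) \<theta>) \<le> card (reduced_words I (Suc j))"
    using assms(1) by (intro card_mono finite_reduced_words) (auto simp: closed_words_def)
  also note card_reduced_words_le[OF assms]
  finally show ?thesis .
qed

section \<open>Cylinder functions and averaging\<close>

definition depends_on :: "'g set \<Rightarrow> ('g config \<Rightarrow> 'b) \<Rightarrow> bool" where
  "depends_on S f \<longleftrightarrow> (\<forall>\<theta> \<eta>. (\<forall>s\<in>S. \<theta> s = \<eta> s) \<longrightarrow> f \<theta> = f \<eta>)"

text \<open>
  The configurations that agree with \<open>\<theta>\<close> on the finite set \<open>S\<close> form an open set on which \<open>f\<close> is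
  constant.
\<close>

lemma depends_on_finite_imp_continuous:
  fixes f :: "'g config \<Rightarrow> 'b::topological_space"
  assumes "finite S" "depends_on S f"
  shows "continuous_on UNIV f"
proof -
  have "open (f -` B)" for B
  proof (subst open_subopen, intro ballI)
    fix \<theta> assume \<theta>: "\<theta> \<in> f -` B"
    let ?C = "\<Inter>s\<in>S. (\<lambda>\<eta>. \<eta> s) -` {\<theta> s}"
    have "open ((\<lambda>\<eta> :: 'g config. \<eta> s) -` {\<theta> s})" for s
      by (rule open_vimage[OF _ continuous_on_product_coordinates]) (rule discrete_topology_class.open_discrete)
    then have "open ?C"
      using assms(1) by (intro open_INT) auto
    moreover have "?C \<subseteq> f -` B"
    proof
      fix \<eta> assume "\<eta> \<in> ?C"
      then have "f \<eta> = f \<theta>"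
        using assms(2) by (auto simp: depends_on_def)
      with \<theta> show "\<eta> \<in> f -` B" by simp
    qed
    ultimately show "\<exists>T. open T \<and> \<theta> \<in> T \<and> T \<subseteq> f -` B"
      by (intro exI[of _ ?C]) auto
  qed
  then show ?thesis
    by (simp add: continuous_on_open_vimage)
qed

lemma borel_measurable_act [measurable]:
  "act g \<in> (borel :: 'g::group_add config measure) \<rightarrow>\<^sub>M borel"
  unfolding act_def
  by (intro borel_measurable_continuous_onI continuous_on_coordinatewise_then_product) simp

text \<open>
  Mass transport: write the integral as a sum over \<open>x\<close> of integrals over \<open>\<theta>\<close> and replace \<open>\<theta>\<close> by
  \<open>act x \<theta>\<close> in the term of \<open>x\<close>, which the invariance of \<open>P\<close> permits. This removes \<open>x\<close> from the
  argument of \<open>f\<close>, and what remains of \<open>u\<close> is its sum along an orbit, which is \<open>1\<close>.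
\<close>

lemma averaging_function_nn_integral:
  fixes f :: "'g::group_add config \<Rightarrow> ennreal"
  assumes count: "countable (UNIV :: 'g set)"
    and u: "averaging_function u" and P: "invariant_prob P"
    and f [measurable]: "f \<in> borel_measurable borel"
  shows "(\<integral>\<^sup>+v. f (act (- fst v) (snd v)) * u v \<partial>perc_measure P) = (\<integral>\<^sup>+\<theta>. f \<theta> \<partial>P)"
proof -
  interpret prob_space P
    using P by (simp add: invariant_prob_def)
  have sets [measurable_cong]: "sets P = sets borel"
    using P by (simp add: invariant_prob_def)
  have inv: "distr P borel (act g) = P" for g
    using P by (simp add: invariant_prob_def)
  have act_P: "act g \<in> P \<rightarrow>\<^sub>M borel" for g
    by measurable
  have u_meas [measurable]: "u \<in> borel_measurable (count_space UNIV \<Otimes>\<^sub>M P)"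
    using u by (simp add: averaging_function_def
        measurable_cong_sets[OF sets_pair_measure_cong[OF refl sets] refl])
  have u_sec: "(\<lambda>\<theta>. u (x, act x \<theta>)) \<in> borel_measurable P" for x
  proof -
    have "(\<lambda>\<theta>. u (x, \<theta>)) \<in> borel_measurable borel"
      using u by (auto simp: averaging_function_def intro: measurable_Pair2)
    then show ?thesis
      using act_P by (rule measurable_compose[rotated])
  qed
  have F_meas: "(\<lambda>v. f (act (- fst v) (snd v))) \<in> borel_measurable (count_space UNIV \<Otimes>\<^sub>M P)"
    using count by (rule measurable_pair_measure_countable1) simp
  have one: "(\<integral>\<^sup>+x. u (x, act x \<theta>) \<partial>count_space UNIV) = 1" for \<theta>
  proof -
    have "bij (uminus :: 'g \<Rightarrow> 'g)"
      by (rule bij_betw_byWitness[where f' = uminus]) auto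
    then have "(\<integral>\<^sup>+x. u (x, act x \<theta>) \<partial>count_space UNIV) =
        (\<integral>\<^sup>+x. u (- x, act (- x) \<theta>) \<partial>count_space UNIV)"
      by (rule nn_integral_bij_count_space[symmetric])
    also have "\<dots> = (\<integral>\<^sup>+x. u (- x + 0, act (- x) \<theta>) \<partial>count_space UNIV)"
      by simp
    also have "\<dots> = 1"
      using u by (simp only: averaging_function_def)
    finally show ?thesis .
  qed
  have "(\<integral>\<^sup>+v. f (act (- fst v) (snd v)) * u v \<partial>perc_measure P) =
      (\<integral>\<^sup>+x. \<integral>\<^sup>+\<theta>. f (act (- x) \<theta>) * u (x, \<theta>) \<partial>P \<partial>count_space UNIV)"
    unfolding perc_measure_def using F_meas
    by (subst nn_integral_fst[symmetric]) simp_all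
  also have "\<dots> = (\<integral>\<^sup>+x. \<integral>\<^sup>+\<theta>. f \<theta> * u (x, act x \<theta>) \<partial>P \<partial>count_space UNIV)"
  proof (rule nn_integral_cong)
    fix x :: 'g
    have "(\<integral>\<^sup>+\<theta>. f (act (- x) \<theta>) * u (x, \<theta>) \<partial>P) =
        (\<integral>\<^sup>+\<theta>. f (act (- x) \<theta>) * u (x, \<theta>) \<partial>distr P borel (act x))"
      by (simp add: inv)
    also have "\<dots> = (\<integral>\<^sup>+\<theta>. f (act (- x) (act x \<theta>)) * u (x, act x \<theta>) \<partial>P)"
      by (rule nn_integral_distr[OF act_P]) (simp add: inv)
    also have "\<dots> = (\<integral>\<^sup>+\<theta>. f \<theta> * u (x, act x \<theta>) \<partial>P)"
      by (simp add: act_def add.assoc[symmetric])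
    finally show "(\<integral>\<^sup>+\<theta>. f (act (- x) \<theta>) * u (x, \<theta>) \<partial>P) =
        (\<integral>\<^sup>+\<theta>. f \<theta> * u (x, act x \<theta>) \<partial>P)" .
  qed
  also have "\<dots> = (\<integral>\<^sup>+\<theta>. \<integral>\<^sup>+x. f \<theta> * u (x, act x \<theta>) \<partial>count_space UNIV \<partial>P)"
    using count u_sec by (intro nn_integral_count_space_nn_integral[symmetric]) auto
  also have "\<dots> = (\<integral>\<^sup>+\<theta>. f \<theta> \<partial>P)"
    by (simp add: nn_integral_cmult one)
  finally show ?thesis .
qed

text \<open>
  Boundedness makes \<open>f\<close> integrable, so that the extended nonnegative integral that occurs in the
  convergence of measure graphs is the real one of weak convergence.
\<close>

lemma averaging_function_integral_cylinder:
  fixes f :: "'g::group_add config \<Rightarrow> real"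
  assumes count: "countable (UNIV :: 'g set)"
    and S: "finite S" "depends_on S f" and bounds: "\<And>\<theta>. 0 \<le> f \<theta>" "\<And>\<theta>. f \<theta> \<le> C"
    and u: "averaging_function u" and P: "invariant_prob P"
  shows "(\<integral>\<^sup>+v. ennreal (f (act (- fst v) (snd v))) * u v \<partial>perc_measure P) =
      ennreal (\<integral>\<theta>. f \<theta> \<partial>P)"
    and "0 \<le> (\<integral>\<theta>. f \<theta> \<partial>P)" and "(\<integral>\<theta>. f \<theta> \<partial>P) \<le> C"
proof -
  interpret prob_space P
    using P by (simp add: invariant_prob_def)
  have [measurable_cong]: "sets P = sets borel"
    using P by (simp add: invariant_prob_def)
  have [measurable]: "f \<in> borel_measurable borel"
    by (intro borel_measurable_continuous_onI depends_on_finite_imp_continuous[OF S])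
  have int: "integrable P f"
    using bounds by (intro integrable_const_bound[where B = C]) auto
  show "(\<integral>\<^sup>+v. ennreal (f (act (- fst v) (snd v))) * u v \<partial>perc_measure P) =
      ennreal (\<integral>\<theta>. f \<theta> \<partial>P)"
    using averaging_function_nn_integral[OF count u P, of "\<lambda>\<theta>. ennreal (f \<theta>)"] int bounds(1)
    by (simp add: nn_integral_eq_integral)
  show "0 \<le> (\<integral>\<theta>. f \<theta> \<partial>P)"
    using bounds(1) by simp
  show "(\<integral>\<theta>. f \<theta> \<partial>P) \<le> C"
    using bounds(2) int by (intro integral_le_const) auto
qed

section \<open>Uniform convergence of exponentials of power series\<close>

text \<open>
  On the disc of radius \<open>r\<close> the distance of the two exponents is at most the sum of
  \<open>\<bar>a n j - b j\<bar> * r ^ Suc j\<close>, which does not involve \<open>z\<close> and tends to zero by Tannery's theorem. All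
  exponents stay in one compact disc, on which the exponential function is uniformly continuous.
\<close>

lemma uniform_limit_exp_power_series:
  fixes a :: "nat \<Rightarrow> nat \<Rightarrow> real" and b :: "nat \<Rightarrow> real" and K :: "complex set"
  assumes lim: "\<And>j. (\<lambda>n. a n j) \<longlonglongrightarrow> b j"
    and bound: "\<And>n j. \<bar>a n j\<bar> \<le> M j"
    and summ: "summable (\<lambda>j. M j * r ^ Suc j)"
    and K: "K \<subseteq> cball 0 r" and r: "0 \<le> r"
  shows "uniform_limit K
     (\<lambda>n z. exp (\<Sum>j. of_real (a n j) / of_nat (Suc j) * z ^ Suc j))
     (\<lambda>z. exp (\<Sum>j. of_real (b j) / of_nat (Suc j) * z ^ Suc j)) sequentially"
proof -
  define s where "s c z = (\<Sum>j. of_real (c j) / of_nat (Suc j) * z ^ Suc j)"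
    for c :: "nat \<Rightarrow> real" and z :: complex
  define B where "B = (\<Sum>j. M j * r ^ Suc j)"
  have bbound: "\<bar>b j\<bar> \<le> M j" for j
    by (rule LIMSEQ_le_const2[OF tendsto_rabs[OF lim]]) (use bound in auto)
  have term_le: "norm (of_real c / of_nat (Suc j) * z ^ Suc j) \<le> \<bar>c\<bar> * r ^ Suc j"
    if "z \<in> K" for c :: real and j and z :: complex
  proof -
    have "norm z \<le> r"
      using that K by auto
    then have "norm z ^ Suc j \<le> r ^ Suc j"
      by (intro power_mono) auto
    moreover have "\<bar>c\<bar> / real (Suc j) \<le> \<bar>c\<bar>"
      by (simp add: field_simps mult_le_cancel_left1)
    ultimately have "\<bar>c\<bar> / real (Suc j) * norm z ^ Suc j \<le> \<bar>c\<bar> * r ^ Suc j"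
      by (intro mult_mono) auto
    then show ?thesis
      by (simp add: norm_mult norm_divide norm_power del: of_nat_Suc power_Suc)
  qed
  have term_le_M: "norm (of_real (c j) / of_nat (Suc j) * z ^ Suc j) \<le> M j * r ^ Suc j"
    if "z \<in> K" "\<And>j. \<bar>c j\<bar> \<le> M j" for c :: "nat \<Rightarrow> real" and j and z :: complex
    using term_le[OF that(1), of "c j" j] that(2)[of j] r
    by (meson mult_right_mono order_trans zero_le_power)
  have s_summable: "summable (\<lambda>j. of_real (c j) / of_nat (Suc j) * z ^ Suc j)"
    if "z \<in> K" "\<And>j. \<bar>c j\<bar> \<le> M j" for c :: "nat \<Rightarrow> real" and z :: complex
    by (rule summable_comparison_test'[OF summ]) (rule term_le_M[OF that])
  have s_bound: "norm (s c z) \<le> B" if "z \<in> K" "\<And>j. \<bar>c j\<bar> \<le> M j" for c z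
    unfolding s_def B_def by (rule norm_suminf_le[OF _ summ]) (rule term_le_M[OF that])
  define d where "d n = (\<Sum>j. \<bar>a n j - b j\<bar> * r ^ Suc j)" for n
  have d_le: "\<bar>a n j - b j\<bar> * r ^ Suc j \<le> 2 * (M j * r ^ Suc j)" for n j
  proof -
    have "\<bar>a n j - b j\<bar> \<le> 2 * M j"
      using bound[of n j] bbound[of j] by linarith
    then have "\<bar>a n j - b j\<bar> * r ^ Suc j \<le> 2 * M j * r ^ Suc j"
      by (rule mult_right_mono) (use r in simp)
    then show ?thesis by (simp only: mult.assoc)
  qed
  have d_norm_le: "norm (\<bar>a n j - b j\<bar> * r ^ Suc j) \<le> 2 * (M j * r ^ Suc j)" for n j
  proof -
    have "0 \<le> \<bar>a n j - b j\<bar> * r ^ Suc j"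
      by (intro mult_nonneg_nonneg zero_le_power r abs_ge_zero)
    with d_le[of n j] show ?thesis
      by (simp only: real_norm_def abs_of_nonneg)
  qed
  have d_summable: "summable (\<lambda>j. \<bar>a n j - b j\<bar> * r ^ Suc j)" for n
    by (rule summable_comparison_test'[OF summable_mult[OF summ]]) (rule d_norm_le)
  have "d \<longlonglongrightarrow> (\<Sum>j. 0)"
    unfolding d_def
  proof (rule tannerys_theorem[THEN conjunct2, THEN conjunct2])
    show "(\<lambda>n. \<bar>a n j - b j\<bar> * r ^ Suc j) \<longlonglongrightarrow> 0" for j
      using lim[of j] by (intro tendsto_mult_left_zero tendsto_rabs_zero) (simp add: LIM_zero)
    show "\<forall>\<^sub>F (j, n) in at_top \<times>\<^sub>F sequentially.
        norm (\<bar>a n j - b j\<bar> * r ^ Suc j) \<le> 2 * (M j * r ^ Suc j)"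
      using d_norm_le by (intro always_eventually) (auto simp only: split_beta)
    show "summable (\<lambda>j. 2 * (M j * r ^ Suc j))"
      by (rule summable_mult[OF summ])
  qed simp
  then have d_lim: "d \<longlonglongrightarrow> 0" by simp
  have diff: "dist (s (a n) z) (s b z) \<le> d n" if z: "z \<in> K" for n z
  proof -
    have "s (a n) z - s b z =
        (\<Sum>j. of_real (a n j - b j) / of_nat (Suc j) * z ^ Suc j)"
      unfolding s_def
      by (subst suminf_diff[OF s_summable[OF z bound] s_summable[OF z bbound]])
        (simp add: diff_divide_distrib left_diff_distrib)
    also have "norm \<dots> \<le> d n"
      unfolding d_def by (rule norm_suminf_le[OF _ d_summable]) (rule term_le[OF z])
    finally show ?thesis by (simp add: dist_norm)
  qed
  have "uniform_limit K (\<lambda>n. s (a n)) (s b) sequentially"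
  proof (rule uniform_limitI)
    fix e :: real assume "0 < e"
    with d_lim have "\<forall>\<^sub>F n in sequentially. d n < e"
      by (rule order_tendstoD)
    then show "\<forall>\<^sub>F n in sequentially. \<forall>z\<in>K. dist (s (a n) z) (s b z) < e"
      by eventually_elim (meson diff le_less_trans)
  qed
  moreover have "uniformly_continuous_on (cball 0 B) (exp :: complex \<Rightarrow> complex)"
    by (intro compact_uniformly_continuous continuous_intros) auto
  moreover have "\<forall>\<^sub>F n in sequentially. \<forall>z\<in>K. s (a n) z \<in> cball 0 B"
    by (intro always_eventually allI ballI) (simp add: s_bound bound)
  ultimately have "uniform_limit K (\<lambda>n z. exp (s (a n) z)) (\<lambda>z. exp (s b z)) sequentially"
    by (rule uniform_limit_compose_uniformly_continuous_on) (rule closed_cball)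
  then show ?thesis
    unfolding s_def .
qed

section \<open>Convergence\<close>

theorem theorem5p11:
  fixes gs :: "nat \<Rightarrow> 'g::group_add"
    and l :: nat
    and I :: "'g set"
    and P :: "('g \<Rightarrow> bool) measure"
    and Pn :: "nat \<Rightarrow> ('g \<Rightarrow> bool) measure"
  assumes "l \<ge> 1"
    and "I = gs ` {1..l} \<union> (\<lambda>i. - gs i) ` {1..l}"
    and "0 \<notin> I"
    and "generates_group I"
    and "invariant_prob P"
    and "\<And>n. invariant_prob (Pn n)"
    and "weakly_converges Pn P"
  shows "measure_graphs_converge (2 * l) (perc_graph I)
           (\<lambda>n. perc_measure (Pn n)) (perc_measure P) \<and>
         (\<forall>u K. averaging_function u \<longrightarrow> compact K \<longrightarrow>
            K \<subseteq> ball (0::complex) (inverse (2 * real l - 1)) \<longrightarrow>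
            uniform_limit K (\<lambda>n. zeta (perc_graph I) (perc_measure (Pn n)) u)
              (zeta (perc_graph I) (perc_measure P) u) sequentially)"
proof -
  have fin: "finite I" and sym: "uminus ` I \<subseteq> I"
    using assms(2) by auto
  have count: "countable (UNIV :: 'g set)"
    using fin sym assms(4) by (rule countable_if_generates_group)
  have card_I: "card I \<le> 2 * l"
  proof -
    have "card I \<le> card (gs ` {1..l}) + card ((\<lambda>i. - gs i) ` {1..l})"
      unfolding assms(2) by (rule card_Un_le)
    also have "\<dots> \<le> card {1..l} + card {1..l}"
      by (intro add_mono card_image_le) auto
    finally show ?thesis by simp
  qed
  have weak: "(\<lambda>n. \<integral>\<theta>. f \<theta> \<partial>Pn n) \<longlonglongrightarrow> (\<integral>\<theta>. f \<theta> \<partial>P)"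
    if "depends_on (word_sums I r) f" for f :: "'g config \<Rightarrow> real" and r
    using assms(7) depends_on_finite_imp_continuous[OF finite_word_sums[OF fin] that]
    by (simp add: weakly_converges_def)

  have graphs: "measure_graphs_converge (2 * l) (perc_graph I)
      (\<lambda>n. perc_measure (Pn n)) (perc_measure P)"
    unfolding measure_graphs_converge_def
  proof (intro allI impI ballI)
    fix u :: "'g \<times> 'g config \<Rightarrow> ennreal" and \<alpha>
    assume u: "averaging_function u" and \<alpha>: "\<alpha> \<in> rooted_classes (2 * l)"
    let ?V = "class_verts (perc_graph I) \<alpha>"
    obtain r where "\<forall>x \<theta> y \<eta>. (\<forall>t\<in>word_sums I r. \<theta> (x + t) = \<eta> (y + t)) \<longrightarrow>
        ((x, \<theta>) \<in> ?V \<longleftrightarrow> (y, \<eta>) \<in> ?V)"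
      using class_verts_perc_graph_local[OF sym \<alpha>] ..
    then have local: "(x, \<theta>) \<in> ?V \<longleftrightarrow> (y, \<eta>) \<in> ?V"
      if "\<forall>t\<in>word_sums I r. \<theta> (x + t) = \<eta> (y + t)" for x \<theta> y \<eta>
      using that by blast
    \<comment> \<open>what the identity element sees determines what every vertex sees\<close>
    define f :: "'g config \<Rightarrow> real" where "f \<theta> = indicator ?V (0, \<theta>)" for \<theta>
    have dep: "depends_on (word_sums I r) f"
      unfolding depends_on_def
    proof (intro allI impI)
      fix \<theta> \<eta> :: "'g config"
      assume "\<forall>s\<in>word_sums I r. \<theta> s = \<eta> s"
      then show "f \<theta> = f \<eta>"
        using local[where x = 0 and y = 0 and \<theta> = \<theta> and \<eta> = \<eta>] by (simp add: f_def indicator_def)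
    qed
    have V: "ennreal (f (act (- fst v) (snd v))) = indicator ?V v" for v
      using local[where \<theta> = "snd v" and x = "fst v" and \<eta> = "act (- fst v) (snd v)" and y = 0]
      by (simp add: f_def act_uminus indicator_def)
    have "(\<integral>\<^sup>+v\<in>?V. u v \<partial>perc_measure Q) = ennreal (\<integral>\<theta>. f \<theta> \<partial>Q)" if "invariant_prob Q" for Q
      using averaging_function_integral_cylinder(1)[OF count finite_word_sums[OF fin] dep _ _ u that,
          of 1]
      by (simp add: V mult.commute) (simp add: f_def)
    then show "(\<lambda>n. \<integral>\<^sup>+v\<in>?V. u v \<partial>perc_measure (Pn n))
        \<longlonglongrightarrow> (\<integral>\<^sup>+v\<in>?V. u v \<partial>perc_measure P)"
      using assms(5,6) weak[OF dep] by (simp add: tendsto_ennrealI)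
  qed

  have "uniform_limit K (\<lambda>n. zeta (perc_graph I) (perc_measure (Pn n)) u)
      (zeta (perc_graph I) (perc_measure P) u) sequentially"
    if u: "averaging_function u" and K: "compact K" "K \<subseteq> ball 0 (inverse (2 * real l - 1))"
    for u :: "'g \<times> 'g config \<Rightarrow> ennreal" and K
  proof -
    define q where "q = 2 * real l - 1"
    have q: "q \<ge> 1"
      using assms(1) by (simp add: q_def)
    \<comment> \<open>a compact subset of the open disc stays away from its boundary\<close>
    obtain r where r: "0 \<le> r" "r < inverse q" "K \<subseteq> cball 0 r"
    proof (cases "K = {}")
      case True
      then show thesis using q that[of 0] by simp
    next
      case False
      then obtain z where "z \<in> K" "\<And>y. y \<in> K \<Longrightarrow> norm y \<le> norm z"
        using continuous_attains_sup[of K norm] K(1) continuous_on_norm_id by blast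
      then show thesis
        using K(2) by (intro that[of "norm z"]) (auto simp: q_def)
    qed
    \<comment> \<open>the number of reduced closed paths of length \<open>Suc j\<close> at the identity element\<close>
    define f :: "nat \<Rightarrow> 'g config \<Rightarrow> real" where "f j \<theta> = card (closed_words I (Suc j) \<theta>)" for j \<theta>
    have dep: "depends_on (word_sums I (Suc j)) (f j)" for j
      unfolding depends_on_def f_def using closed_words_cong[of I "Suc j"] by metis
    have f_le: "f j \<theta> \<le> 2 * real l * q ^ j" for j \<theta>
    proof -
      have "card (closed_words I (Suc j) \<theta>) \<le> card I * (card I - 1) ^ j"
        by (rule card_closed_words_le[OF fin sym])
      also have "\<dots> \<le> 2 * l * (2 * l - 1) ^ j"
        using card_I by (intro mult_le_mono power_mono diff_le_mono) auto
      finally have "card (closed_words I (Suc j) \<theta>) \<le> 2 * l * (2 * l - 1) ^ j" .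
      then have "f j \<theta> \<le> real (2 * l * (2 * l - 1) ^ j)"
        unfolding f_def by (rule of_nat_mono)
      then show ?thesis
        using assms(1) by (simp add: q_def of_nat_diff)
    qed
    have mean: "mean_closed (perc_graph I) (perc_measure Q) u (Suc j) = (\<integral>\<theta>. f j \<theta> \<partial>Q)"
      and mean_le: "\<bar>\<integral>\<theta>. f j \<theta> \<partial>Q\<bar> \<le> 2 * real l * q ^ j" if "invariant_prob Q" for Q j
    proof -
      have nonneg: "0 \<le> f j \<theta>" for \<theta>
        by (simp add: f_def)
      note cyl = averaging_function_integral_cylinder[OF count finite_word_sums[OF fin] dep
          nonneg f_le u that]
      have N: "of_nat (num_closed (perc_graph I) (Suc j) v) =
          ennreal (f j (act (- fst v) (snd v)))" for v
        using num_closed_perc_graph[OF sym, of j "fst v" "snd v"]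
        by (simp add: f_def ennreal_of_nat_eq_real_of_nat)
      show "mean_closed (perc_graph I) (perc_measure Q) u (Suc j) = (\<integral>\<theta>. f j \<theta> \<partial>Q)"
        unfolding mean_closed_def N cyl(1) using cyl(2) by simp
      show "\<bar>\<integral>\<theta>. f j \<theta> \<partial>Q\<bar> \<le> 2 * real l * q ^ j"
        using cyl(2,3) by simp
    qed
    have "q * r < 1"
      using q r(2) by (simp add: field_simps)
    then have "summable (\<lambda>j. 2 * real l * r * (q * r) ^ j)"
      using q r(1) by (intro summable_mult summable_geometric) simp
    then have summ: "summable (\<lambda>j. 2 * real l * q ^ j * r ^ Suc j)"
      by (simp add: power_mult_distrib ac_simps)
    show ?thesis
      unfolding zeta_def[abs_def] mean[OF assms(5)] mean[OF assms(6)]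
      by (rule uniform_limit_exp_power_series[OF weak[OF dep] mean_le[OF assms(6)] summ r(3,1)])
  qed
  with graphs show ?thesis by blast
qed

end
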